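(* Let $X$ be a finite set with $n=|X|\geq 3$, and for $1\le r\le n-1$ let $J_r=\{\alpha\in\mathcal{I}(X):\operatorname{rank}(\alpha)\leq r\}$ (these are the proper nonzero ideals of $\mathcal{I}(X)$). Let $\mathcal{G}(J_r)$ be the commuting graph of $J_r$. Then: (1) The diameter of $\mathcal{G}(J_{n-1})$ is $4$. (2) If $\lfloor\frac{n-1}{2}\rfloor<r<n-1$, then the diameter of $\mathcal{G}(J_r)$ is $3$. (3) If $1\leq r\leq\lfloor\frac{n-1}{2}\rfloor$, then the diameter of $\mathcal{G}(J_r)$ is $2$.
   Context: For a finite set $X$, $\mathcal{I}(X)$ is the symmetric inverse semigroup on $X$: all partial injective transformations of $X$ (injective functions whose domain and image are subsets of $X$) under composition of partial functions. The rank of $\alpha\in\mathcal{I}(X)$ is $|\operatorname{im}(\alpha)|$. The commuting graph $\mathcal{G}(S)$ of a finite non-commutative semigroup $S$ is the simple graph whose vertices are the elements of $S$ not in the center $Z(S)=\{a\in S: ab=ba\text{ for all }b\in S\}$, two distinct vertices $a,b$ being adjacent iff $ab=ba$. The diameter of a graph is the maximum distance between two of its vertices, where distance is the length (number of edges) of a shortest path, or $\infty$ if no path exists. *)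

theory Defs
  imports "Graph_Theory.Graph_Theory"
begin

text \<open>
  A partial transformation of \<open>X\<close> is a map \<open>'a \<rightharpoonup> 'a\<close> whose domain and image lie in \<open>X\<close>. The
  product is \<open>map_comp\<close>, i.e. \<open>(\<alpha> \<circ>\<^sub>m \<beta>) x = \<alpha> (\<beta> x)\<close>; composing in the opposite
  order would give the same commuting pairs.
\<close>

definition sym_inv_semigroup :: "'a set \<Rightarrow> ('a \<rightharpoonup> 'a) set" where
  "sym_inv_semigroup X = {\<alpha>. dom \<alpha> \<subseteq> X \<and> ran \<alpha> \<subseteq> X \<and> inj_on \<alpha> (dom \<alpha>)}"

definition map_rank :: "('a \<rightharpoonup> 'a) \<Rightarrow> nat" where
  "map_rank \<alpha> = card (ran \<alpha>)"

definition rank_ideal :: "'a set \<Rightarrow> nat \<Rightarrow> ('a \<rightharpoonup> 'a) set" where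
  "rank_ideal X r = {\<alpha> \<in> sym_inv_semigroup X. map_rank \<alpha> \<le> r}"

definition semigroup_center :: "('s \<Rightarrow> 's \<Rightarrow> 's) \<Rightarrow> 's set \<Rightarrow> 's set" where
  "semigroup_center f S = {a \<in> S. \<forall>b\<in>S. f a b = f b a}"

text \<open>Simple graphs are represented as symmetric loop-free digraphs.\<close>

definition commuting_graph :: "('s \<Rightarrow> 's \<Rightarrow> 's) \<Rightarrow> 's set \<Rightarrow> 's pair_pre_digraph" where
  "commuting_graph f S = \<lparr>
     pverts = S - semigroup_center f S,
     parcs = {(a, b). a \<in> S - semigroup_center f S \<and> b \<in> S - semigroup_center f S \<and>
                      a \<noteq> b \<and> f a b = f b a}\<rparr>"

text \<open>
  With every arc of cost 1, \<open>wf_digraph.\<mu>\<close> is the usual distance, with value \<open>\<infinity>\<close> if there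
  is no path.
\<close>

definition distance :: "('a, 'b) pre_digraph \<Rightarrow> 'a \<Rightarrow> 'a \<Rightarrow> ereal" where
  "distance G u v = wf_digraph.\<mu> G (\<lambda>_. 1) u v"

definition diameter :: "('a, 'b) pre_digraph \<Rightarrow> ereal" where
  "diameter G = (SUP u\<in>verts G. SUP v\<in>verts G. distance G u v)"

lemma wf_digraph_commuting_graph: "wf_digraph (with_proj (commuting_graph f S))"
  unfolding wf_digraph_wp_iff by unfold_locales (auto simp: commuting_graph_def)

lemma pair_graph_commuting_graph:
  assumes "finite S"
  shows "pair_graph (commuting_graph f S)"
proof -
  have "finite (parcs (commuting_graph f S))"
    by (rule finite_subset[of _ "S \<times> S"]) (auto simp: commuting_graph_def assms)
  moreover have "finite (pverts (commuting_graph f S))"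
    using assms by (simp add: commuting_graph_def)
  ultimately show ?thesis
    by unfold_locales
      (auto simp: commuting_graph_def symmetric_def arcs_ends_def arc_to_ends_def sym_def image_def)
qed

lemma finite_rank_ideal:
  assumes "finite X"
  shows "finite (rank_ideal X r)"
proof -
  have "finite {\<alpha> :: 'a \<rightharpoonup> 'a. dom \<alpha> \<subseteq> X \<and> ran \<alpha> \<subseteq> X}"
  proof -
    have "{\<alpha> :: 'a \<rightharpoonup> 'a. dom \<alpha> \<subseteq> X \<and> ran \<alpha> \<subseteq> X} =
      (\<Union>D\<in>Pow X. {\<alpha>. dom \<alpha> = D \<and> ran \<alpha> \<subseteq> X})" by auto
    then show ?thesis
      using assms by (auto intro!: finite_set_of_finite_maps dest: finite_subset)
  qed
  then show ?thesis
    by (rule finite_subset[rotated]) (auto simp: rank_ideal_def sym_inv_semigroup_def)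
qed

end

theory Submission
  imports Defs
begin

text \<open>
  If \<open>x \<notin> ran \<alpha>\<close> and \<open>y \<notin> dom \<alpha>\<close>, then the rank-one map \<open>[x \<mapsto> y]\<close> annihilates \<open>\<alpha>\<close> on both
  sides. Counting the points that are available for \<open>x\<close> and \<open>y\<close> gives all upper bounds.

  For the lower bound 3, restrict an \<open>n\<close>-cycle on \<open>X\<close> to a set \<open>A\<close> and to its complement: the domain
  of a map commuting with both restrictions is invariant under the cycle, so the map is empty or of
  rank \<open>n\<close>. For the lower bound 4, take the chain \<open>x\<^sub>0 \<mapsto> x\<^sub>1 \<mapsto> \<dots> \<mapsto> x\<^sub>n\<^sub>-\<^sub>1\<close> and its
  reversal: the nonempty maps of rank less than \<open>n\<close> commuting with a chain are its proper powers, and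
  no power of the chain commutes with a power of the reversed chain.
\<close>

section \<open>Distances in commuting graphs\<close>

text \<open>Unlike the arcs of \<open>commuting_graph\<close>, this relation keeps the diagonal on
  the vertices. Its k-th relational power therefore expresses distance at most k between vertices,
  not a walk of exactly k arcs.\<close>

definition commuting_rel :: "('s \<Rightarrow> 's \<Rightarrow> 's) \<Rightarrow> 's set \<Rightarrow> 's rel" where
  "commuting_rel f S = {(a, b). a \<in> S - semigroup_center f S \<and> b \<in> S - semigroup_center f S \<and>
     f a b = f b a}"

lemma commuting_graph_simps:
  "pverts (commuting_graph f S) = S - semigroup_center f S"
  "e \<in> parcs (commuting_graph f S) \<longleftrightarrow> e \<in> commuting_rel f S \<and> fst e \<noteq> snd e"
  by (auto simp: commuting_graph_def commuting_rel_def)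

lemma relpow_commuting_rel_refl:
  assumes "a \<in> S - semigroup_center f S"
  shows "(a, a) \<in> commuting_rel f S ^^ k"
proof (induction k)
  case (Suc k)
  then show ?case
    using assms by (auto simp: commuting_rel_def)
qed simp

text \<open>A walk that is too short is padded with diagonal steps at its end point.\<close>

lemma awalk_imp_relpow:
  assumes "pre_digraph.awalk (with_proj (commuting_graph f S)) a p b" and "length p \<le> k"
  shows "(a, b) \<in> commuting_rel f S ^^ k"
  using assms
proof (induction p arbitrary: a k)
  case Nil
  interpret wf_digraph "with_proj (commuting_graph f S)"
    by (rule wf_digraph_commuting_graph)
  from Nil show ?case
    by (auto simp: awalk_Nil_iff commuting_graph_simps intro!: relpow_commuting_rel_refl)
next
  case (Cons e p)
  interpret wf_digraph "with_proj (commuting_graph f S)"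
    by (rule wf_digraph_commuting_graph)
  obtain l where k: "k = Suc l"
    using Cons.prems(2) by (cases k) auto
  have "(a, snd e) \<in> commuting_rel f S" and "awalk (snd e) p b"
    using Cons.prems(1) by (auto simp: awalk_Cons_iff commuting_graph_simps)
  then show ?case
    using Cons.IH[of "snd e" l] Cons.prems(2) unfolding k by (metis Suc_le_mono length_Cons relpow_Suc_I2)
qed

text \<open>Diagonal steps contribute no arc, so only a bound on the length results. That
  \<open>a\<close> is a vertex matters for k = 0, where the power is the identity on the whole
  type.\<close>

lemma relpow_imp_awalk:
  assumes "(a, b) \<in> commuting_rel f S ^^ k" and "a \<in> S - semigroup_center f S"
  shows "\<exists>p. pre_digraph.awalk (with_proj (commuting_graph f S)) a p b \<and> length p \<le> k"
  using assms
proof (induction k arbitrary: a)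
  case 0
  interpret wf_digraph "with_proj (commuting_graph f S)"
    by (rule wf_digraph_commuting_graph)
  from 0 show ?case
    by (auto simp: awalk_Nil_iff commuting_graph_simps)
next
  case (Suc k)
  interpret wf_digraph "with_proj (commuting_graph f S)"
    by (rule wf_digraph_commuting_graph)
  obtain c where c: "(a, c) \<in> commuting_rel f S" "(c, b) \<in> commuting_rel f S ^^ k"
    using Suc.prems(1) relpow_Suc_D2 by metis
  then obtain p where p: "awalk c p b" "length p \<le> k"
    using Suc.IH[of c] by (auto simp: commuting_rel_def)
  show ?case
  proof (cases "a = c")
    case True
    then show ?thesis
      using p le_SucI by blast
  next
    case False
    then have "awalk a ((a, c) # p) b"
      using p(1) c(1) by (auto simp: awalk_Cons_iff commuting_graph_simps)
    then show ?thesis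
      using p(2) by (metis Suc_le_mono length_Cons)
  qed
qed

lemma diameter_commuting_graph_eqI:
  assumes upper: "\<And>a b. a \<in> S - semigroup_center f S \<Longrightarrow> b \<in> S - semigroup_center f S \<Longrightarrow>
      (a, b) \<in> commuting_rel f S ^^ Suc k"
    and ab: "a \<in> S - semigroup_center f S" "b \<in> S - semigroup_center f S"
    and lower: "(a, b) \<notin> commuting_rel f S ^^ k"
  shows "diameter (commuting_graph f S) = ereal (real (Suc k))"
proof -
  let ?G = "with_proj (commuting_graph f S)"
  interpret wf_digraph ?G
    by (rule wf_digraph_commuting_graph)
  have verts: "verts ?G = S - semigroup_center f S"
    by (simp add: commuting_graph_simps)
  have cost: "awalk_cost (\<lambda>_. 1) p = real (length p)" for p :: "('a \<times> 'a) list"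
    by (induction p) auto
  have "distance ?G u v \<le> ereal (real (Suc k))" if uv: "u \<in> verts ?G" "v \<in> verts ?G" for u v
  proof -
    obtain p where "awalk u p v" "length p \<le> Suc k"
      using relpow_imp_awalk[OF upper[OF uv[unfolded verts]] uv(1)[unfolded verts]] by blast
    then show ?thesis
      using min_cost_le_walk_cost[of u p v "\<lambda>_. 1"] unfolding distance_def cost
      by (meson ereal_less_eq(3) of_nat_le_iff order_trans)
  qed
  then have "diameter ?G \<le> ereal (real (Suc k))"
    unfolding diameter_def by (intro SUP_least)
  \<comment> \<open>The distance is an infimum over walks, so it suffices to bound each walk.
    Without any walk the infimum is infinite and the bound still holds.\<close>
  moreover have "ereal (real (Suc k)) \<le> distance ?G a b"
    unfolding distance_def \<mu>_def cost
  proof (rule INF_greatest)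
    fix p assume "p \<in> {p. awalk a p b}"
    then have "\<not> length p \<le> k"
      using awalk_imp_relpow[of f S a p b k] lower by auto
    then show "ereal (real (Suc k)) \<le> ereal (real (length p))"
      by simp
  qed
  moreover have "distance ?G a b \<le> diameter ?G"
    unfolding diameter_def using ab unfolding verts[symmetric]
    by (intro SUP_upper2[of a] SUP_upper2[of b] order_refl)
  ultimately show ?thesis
    by (meson antisym order_trans)
qed

section \<open>Ideals of the symmetric inverse semigroup\<close>

lemma rank_ideal_simps:
  assumes "\<alpha> \<in> rank_ideal X r"
  shows "dom \<alpha> \<subseteq> X" "ran \<alpha> \<subseteq> X" "card (ran \<alpha>) \<le> r" "card (dom \<alpha>) = card (ran \<alpha>)"
proof -
  show "dom \<alpha> \<subseteq> X" "ran \<alpha> \<subseteq> X" "card (ran \<alpha>) \<le> r"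
    using assms by (auto simp: rank_ideal_def sym_inv_semigroup_def map_rank_def)
  have "inj_on \<alpha> (dom \<alpha>)"
    using assms by (auto simp: rank_ideal_def sym_inv_semigroup_def)
  \<comment> \<open>Stripping \<open>Some\<close> turns \<alpha> into an ordinary bijection from its
    domain onto its range, so the two have equal size.\<close>
  then have "inj_on (the \<circ> \<alpha>) (dom \<alpha>)"
    by (intro comp_inj_on) (auto simp: inj_on_def)
  moreover have "(the \<circ> \<alpha>) ` dom \<alpha> = ran \<alpha>"
    by (force simp: ran_def)
  ultimately show "card (dom \<alpha>) = card (ran \<alpha>)"
    by (metis card_image)
qed

lemma rank_one_mem:
  assumes "x \<in> X" "y \<in> X" "1 \<le> r"
  shows "[x \<mapsto> y] \<in> rank_ideal X r - {Map.empty}"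
  using assms by (auto simp: rank_ideal_def sym_inv_semigroup_def map_rank_def)

lemma rank_one_annihilates:
  assumes "x \<notin> ran \<alpha>" "y \<notin> dom \<alpha>"
  shows "\<alpha> \<circ>\<^sub>m [x \<mapsto> y] = Map.empty" "[x \<mapsto> y] \<circ>\<^sub>m \<alpha> = Map.empty"
  using assms by (auto simp: map_comp_def fun_eq_iff ran_def split: option.splits)

text \<open>This makes the nonempty maps the vertices. Rank below n leaves a point y outside the
  domain. If \<alpha> sends x to z, then \<alpha> followed by \<open>[z \<mapsto> y]\<close> sends x
  to y, but in the other order x has no image, since \<alpha> is undefined at y.\<close>

lemma semigroup_center_rank_ideal:
  assumes "finite X" "1 \<le> r" "r < card X"
  shows "semigroup_center (\<circ>\<^sub>m) (rank_ideal X r) = {Map.empty}"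
proof
  show "{Map.empty} \<subseteq> semigroup_center (\<circ>\<^sub>m) (rank_ideal X r)"
    by (auto simp: semigroup_center_def rank_ideal_def sym_inv_semigroup_def map_rank_def
        map_comp_def fun_eq_iff split: option.splits)
  show "semigroup_center (\<circ>\<^sub>m) (rank_ideal X r) \<subseteq> {Map.empty}"
  proof
    fix \<alpha> assume "\<alpha> \<in> semigroup_center (\<circ>\<^sub>m) (rank_ideal X r)"
    then have \<alpha>: "\<alpha> \<in> rank_ideal X r"
      and comm: "\<beta> \<in> rank_ideal X r \<Longrightarrow> \<alpha> \<circ>\<^sub>m \<beta> = \<beta> \<circ>\<^sub>m \<alpha>" for \<beta>
      by (auto simp: semigroup_center_def)
    have "card (dom \<alpha>) < card X"
      using rank_ideal_simps[OF \<alpha>] assms(3) by linarith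
    then obtain y where y: "y \<in> X" "\<alpha> y = None"
      using rank_ideal_simps(1)[OF \<alpha>] by (metis domIff less_irrefl subsetI subset_antisym)
    have "\<alpha> x = None" for x
    proof (rule ccontr)
      assume "\<alpha> x \<noteq> None"
      then obtain z where z: "\<alpha> x = Some z" "x \<in> X" "z \<in> X"
        using rank_ideal_simps(1,2)[OF \<alpha>] by (auto simp: dom_def ran_def)
      have "(\<alpha> \<circ>\<^sub>m [z \<mapsto> y]) x = ([z \<mapsto> y] \<circ>\<^sub>m \<alpha>) x"
        using comm[of "[z \<mapsto> y]"] rank_one_mem[OF z(3) y(1) assms(2)] by simp
      then show False
        using y z by (simp add: map_comp_def split: if_splits)
    qed
    then show "\<alpha> \<in> {Map.empty}"
      by auto
  qed
qed

lemma exists_outside_two: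
  assumes "finite X" "card A + card B < card X" "finite A" "finite B"
  obtains x where "x \<in> X" "x \<notin> A" "x \<notin> B"
proof -
  have "card (A \<union> B) < card X"
    using card_Un_le[of A B] assms(2) by linarith
  then have "\<not> X \<subseteq> A \<union> B"
    using card_mono[of "A \<union> B" X] assms(3,4) by auto
  then show thesis
    using that by auto
qed

text \<open>Two separate rank bounds let one count serve every upper bound below: it is applied with
  (r, 0), (r, r), (r, 1) and (1, 1).\<close>

lemma common_annihilator:
  assumes "finite X" and \<alpha>: "\<alpha> \<in> rank_ideal X r" and \<beta>: "\<beta> \<in> rank_ideal X s" and "r + s < card X"
  obtains x y where "x \<in> X" "y \<in> X" "x \<notin> ran \<alpha>" "x \<notin> ran \<beta>" "y \<notin> dom \<alpha>" "y \<notin> dom \<beta>"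
proof -
  note * = rank_ideal_simps[OF \<alpha>] rank_ideal_simps[OF \<beta>]
  have fin: "finite (dom \<alpha>)" "finite (ran \<alpha>)" "finite (dom \<beta>)" "finite (ran \<beta>)"
    using * assms(1) finite_subset by blast+
  have card: "card (ran \<alpha>) + card (ran \<beta>) < card X" "card (dom \<alpha>) + card (dom \<beta>) < card X"
    using * assms(4) by linarith+
  obtain x where "x \<in> X" "x \<notin> ran \<alpha>" "x \<notin> ran \<beta>"
    using exists_outside_two[of X "ran \<alpha>" "ran \<beta>"] card fin assms(1) by metis
  moreover obtain y where "y \<in> X" "y \<notin> dom \<alpha>" "y \<notin> dom \<beta>"
    using exists_outside_two[of X "dom \<alpha>" "dom \<beta>"] card fin assms(1) by metis
  ultimately show thesis
    using that by blast
qed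

section \<open>Upper bounds on distances\<close>

locale proper_rank_ideal =
  fixes X :: "'a set" and r :: nat
  assumes finite_X: "finite X" and r_pos: "1 \<le> r" and r_less: "r < card X"
begin

abbreviation C :: "('a \<rightharpoonup> 'a) rel" where
  "C \<equiv> commuting_rel (\<circ>\<^sub>m) (rank_ideal X r)"

lemmas center = semigroup_center_rank_ideal[OF finite_X r_pos r_less]

lemma C_iff:
  "(\<alpha>, \<beta>) \<in> C \<longleftrightarrow> \<alpha> \<in> rank_ideal X r - {Map.empty} \<and> \<beta> \<in> rank_ideal X r - {Map.empty} \<and>
     \<alpha> \<circ>\<^sub>m \<beta> = \<beta> \<circ>\<^sub>m \<alpha>"
  by (auto simp: commuting_rel_def center)

lemma C_sym: "(\<alpha>, \<beta>) \<in> C \<Longrightarrow> (\<beta>, \<alpha>) \<in> C"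
  by (simp add: C_iff)

lemma annihilator_C:
  assumes "\<alpha> \<in> rank_ideal X r - {Map.empty}" "x \<in> X" "y \<in> X" "x \<notin> ran \<alpha>" "y \<notin> dom \<alpha>"
  shows "(\<alpha>, [x \<mapsto> y]) \<in> C"
  using assms rank_one_mem[OF assms(2,3) r_pos] by (simp add: C_iff rank_one_annihilates)

lemma annihilator_exists:
  assumes "\<alpha> \<in> rank_ideal X r - {Map.empty}"
  obtains x y where "x \<in> X" "y \<in> X" "(\<alpha>, [x \<mapsto> y]) \<in> C"
proof -
  \<comment> \<open>With the empty map as second partner, a common annihilator is just an
    annihilator of \<alpha>, and r + 0 < n suffices.\<close>
  have "Map.empty \<in> rank_ideal X 0"
    by (simp add: rank_ideal_def sym_inv_semigroup_def map_rank_def)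
  then obtain x y where "x \<in> X" "y \<in> X" "x \<notin> ran \<alpha>" "y \<notin> dom \<alpha>"
    using common_annihilator[of X \<alpha> r Map.empty 0] finite_X assms r_less by auto
  then show thesis
    using that annihilator_C assms by blast
qed

lemma relpow_2:
  assumes "\<alpha> \<in> rank_ideal X r - {Map.empty}" "\<beta> \<in> rank_ideal X r - {Map.empty}" "2 * r < card X"
  shows "(\<alpha>, \<beta>) \<in> C ^^ 2"
proof -
  obtain x y where "x \<in> X" "y \<in> X" "x \<notin> ran \<alpha>" "x \<notin> ran \<beta>" "y \<notin> dom \<alpha>" "y \<notin> dom \<beta>"
    using common_annihilator[of X \<alpha> r \<beta> r] assms finite_X by auto
  then have "(\<alpha>, [x \<mapsto> y]) \<in> C" "([x \<mapsto> y], \<beta>) \<in> C"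
    using annihilator_C C_sym assms by blast+
  then show ?thesis
    by (auto simp: numeral_2_eq_2)
qed

text \<open>The path is \<alpha>, \<open>[x \<mapsto> y]\<close>, \<open>[z \<mapsto> w]\<close>,
  \<beta>. The second inner vertex annihilates both \<beta> and the rank-one map
  \<open>[x \<mapsto> y]\<close>, which is where r + 1 < n enters.\<close>

lemma relpow_3:
  assumes \<alpha>: "\<alpha> \<in> rank_ideal X r - {Map.empty}" and \<beta>: "\<beta> \<in> rank_ideal X r - {Map.empty}"
    and r: "r + 1 < card X"
  shows "(\<alpha>, \<beta>) \<in> C ^^ 3"
proof -
  obtain x y where xy: "x \<in> X" "y \<in> X" "(\<alpha>, [x \<mapsto> y]) \<in> C"
    using annihilator_exists[OF \<alpha>] by blast
  have xy1: "[x \<mapsto> y] \<in> rank_ideal X 1"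
    using rank_one_mem[OF xy(1,2), of 1] by simp
  obtain z w where zw: "z \<in> X" "w \<in> X" "z \<notin> ran \<beta>" "z \<notin> ran [x \<mapsto> y]"
      "w \<notin> dom \<beta>" "w \<notin> dom [x \<mapsto> y]"
    by (rule common_annihilator[OF finite_X DiffD1[OF \<beta>] xy1 r])
  have "([x \<mapsto> y], [z \<mapsto> w]) \<in> C"
    using annihilator_C[of "[x \<mapsto> y]" z w] rank_one_mem[OF xy(1,2) r_pos] zw by auto
  moreover have "([z \<mapsto> w], \<beta>) \<in> C"
    using annihilator_C C_sym \<beta> zw by blast
  ultimately show ?thesis
    using xy(3) by (auto simp: numeral_3_eq_3)
qed

text \<open>For r = n - 1 the count r + 1 < n fails, so each end gets its own rank-one annihilator.
  A third rank-one map annihilates both of these, since 1 + 1 < n.\<close>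

lemma relpow_4:
  assumes \<alpha>: "\<alpha> \<in> rank_ideal X r - {Map.empty}" and \<beta>: "\<beta> \<in> rank_ideal X r - {Map.empty}"
    and X: "3 \<le> card X"
  shows "(\<alpha>, \<beta>) \<in> C ^^ 4"
proof -
  obtain x y where xy: "x \<in> X" "y \<in> X" "(\<alpha>, [x \<mapsto> y]) \<in> C"
    using annihilator_exists[OF \<alpha>] by blast
  obtain z w where zw: "z \<in> X" "w \<in> X" "(\<beta>, [z \<mapsto> w]) \<in> C"
    using annihilator_exists[OF \<beta>] by blast
  have "[x \<mapsto> y] \<in> rank_ideal X 1" "[z \<mapsto> w] \<in> rank_ideal X 1"
    using rank_one_mem[OF xy(1,2), of 1] rank_one_mem[OF zw(1,2), of 1] by auto
  then obtain p q where pq: "p \<in> X" "q \<in> X" "p \<notin> ran [x \<mapsto> y]" "p \<notin> ran [z \<mapsto> w]"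
      "q \<notin> dom [x \<mapsto> y]" "q \<notin> dom [z \<mapsto> w]"
    using common_annihilator[of X "[x \<mapsto> y]" 1 "[z \<mapsto> w]" 1] finite_X X by auto
  then have "([x \<mapsto> y], [p \<mapsto> q]) \<in> C" "([p \<mapsto> q], [z \<mapsto> w]) \<in> C"
    using annihilator_C[OF rank_one_mem[OF xy(1,2) r_pos], of p q]
      C_sym[OF annihilator_C[OF rank_one_mem[OF zw(1,2) r_pos], of p q]] by simp_all
  then have "(\<alpha>, \<beta>) \<in> C ^^ Suc (Suc (Suc (Suc 0)))"
    using xy(3) C_sym[OF zw(3)] by (auto simp: relcomp_unfold)
  then show ?thesis
    by (simp add: numeral_eq_Suc)
qed

end

section \<open>Restrictions of a cycle\<close>

text \<open>The n-cycle h 0, h 1, ..., h (n - 1) and back to h 0. It is meaningful only on the image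
  of \<open>h\<close>, so it is used only through restrictions to subsets of X.\<close>

definition cyclic_shift :: "(nat \<Rightarrow> 'a) \<Rightarrow> nat \<Rightarrow> 'a \<Rightarrow> 'a" where
  "cyclic_shift h n x = h (Suc (the_inv_into {..<n} h x) mod n)"

locale cycle =
  fixes h :: "nat \<Rightarrow> 'a" and n :: nat and X :: "'a set"
  assumes h: "bij_betw h {..<n} X"
begin

abbreviation restr :: "'a set \<Rightarrow> 'a \<rightharpoonup> 'a" where
  "restr A \<equiv> (Some \<circ> cyclic_shift h n) |` A"

lemma finite_X: "finite X"
  using h bij_betw_finite by blast

lemma card_X: "card X = n"
  using bij_betw_same_card[OF h] by simp

lemma h_mem: "i < n \<Longrightarrow> h i \<in> X"
  using h by (auto simp: bij_betw_def)

lemma h_eq_iff: "i < n \<Longrightarrow> j < n \<Longrightarrow> h i = h j \<longleftrightarrow> i = j"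
  using h by (auto simp: bij_betw_def inj_on_def)

lemma X_cases:
  assumes "x \<in> X"
  obtains i where "i < n" "x = h i"
  using assms h by (auto simp: bij_betw_def)

lemma cyclic_shift_h: "i < n \<Longrightarrow> cyclic_shift h n (h i) = h (Suc i mod n)"
  using h by (simp add: cyclic_shift_def bij_betw_def the_inv_into_f_f)

lemma inj_on_cyclic_shift: "inj_on (cyclic_shift h n) X"
proof (rule inj_onI)
  fix x y assume "x \<in> X" "y \<in> X" and eq: "cyclic_shift h n x = cyclic_shift h n y"
  then obtain i j where ij: "i < n" "j < n" "x = h i" "y = h j"
    by (metis X_cases)
  then have "Suc i mod n = Suc j mod n"
    using eq by (simp add: cyclic_shift_h h_eq_iff)
  then have "i = j"
    using ij(1,2) by (auto simp: mod_Suc split: if_splits)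
  then show "x = y"
    using ij by simp
qed

lemma restr_mem:
  assumes "A \<subseteq> X" "A \<noteq> {}" "card A \<le> r"
  shows "restr A \<in> rank_ideal X r - {Map.empty}"
proof -
  have ran: "ran (restr A) = cyclic_shift h n ` A"
    by (auto simp: ran_def restrict_map_def)
  have "cyclic_shift h n x \<in> X" if x: "x \<in> A" for x
  proof -
    obtain i where "i < n" "x = h i"
      using X_cases x assms(1) by blast
    then show ?thesis
      by (simp add: cyclic_shift_h h_mem)
  qed
  moreover have "card (ran (restr A)) \<le> r"
    unfolding ran using assms finite_X by (meson card_image_le finite_subset le_trans)
  moreover have "inj_on (restr A) (dom (restr A))"
    using inj_on_subset[OF inj_on_cyclic_shift assms(1)]
    by (auto simp: inj_on_def dom_def restrict_map_def split: if_splits)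
  moreover have "restr A \<noteq> Map.empty"
    using assms(2) by (auto simp: restrict_map_def fun_eq_iff)
  ultimately show ?thesis
    using assms(1) by (auto simp: rank_ideal_def sym_inv_semigroup_def map_rank_def ran)
qed

text \<open>A single cycle is transitive: iterating it from one point of D visits all of X.\<close>

lemma shift_invariant:
  assumes "D \<subseteq> X" "D \<noteq> {}" and inv: "\<And>x. x \<in> D \<Longrightarrow> cyclic_shift h n x \<in> D"
  shows "D = X"
proof -
  obtain i where i: "i < n" "h i \<in> D"
    using assms(1,2) by (metis X_cases ex_in_conv subsetD)
  have *: "h ((i + j) mod n) \<in> D" for j
  proof (induction j)
    case (Suc j)
    have "cyclic_shift h n (h ((i + j) mod n)) = h ((i + Suc j) mod n)"
      using i(1) by (simp add: cyclic_shift_h mod_Suc_eq)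
    then show ?case
      using inv[OF Suc] by simp
  qed (use i in simp)
  \<comment> \<open>Starting at index i, n - i + k steps lead to index n + k, which is k modulo
    n.\<close>
  have "h k \<in> D" if "k < n" for k
    using *[of "n - i + k"] i(1) that by simp
  then show ?thesis
    using assms(1) by (metis X_cases subsetI subset_antisym)
qed

lemma commutes_with_complementary_restrs:
  assumes \<gamma>: "\<gamma> \<in> rank_ideal X r" "r < n" and "A \<subseteq> X"
    and commA: "\<gamma> \<circ>\<^sub>m restr A = restr A \<circ>\<^sub>m \<gamma>"
    and commB: "\<gamma> \<circ>\<^sub>m restr (X - A) = restr (X - A) \<circ>\<^sub>m \<gamma>"
  shows "\<gamma> = Map.empty"
proof (rule ccontr)
  assume "\<gamma> \<noteq> Map.empty"
  note \<gamma>' = rank_ideal_simps[OF \<gamma>(1)]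
  have "cyclic_shift h n x \<in> dom \<gamma>" if x: "x \<in> dom \<gamma>" for x
  proof -
    obtain y where y: "\<gamma> x = Some y" "x \<in> X" "y \<in> X"
      using \<gamma>'(1,2) x by (metis domD ranI subsetD)
    \<comment> \<open>The value y lies in A or in X - A, and the restriction to that set is defined
      at y. In the matching equation the right side is then defined at x, hence so is the left side,
      and this puts the shift of x into the domain of \<gamma>.\<close>
    show ?thesis
      using fun_cong[OF commA, of x] fun_cong[OF commB, of x] y
      by (auto simp: map_comp_def restrict_map_def split: if_splits)
  qed
  then have "dom \<gamma> = X"
    using shift_invariant[of "dom \<gamma>"] \<gamma>'(1) \<open>\<gamma> \<noteq> Map.empty\<close> by auto
  then show False
    using \<gamma>' \<gamma>(2) card_X by simp
qed

text \<open>Commutation at h i computes \<gamma> at h (i + 1) from its value at h i, so \<gamma> is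
  determined by its value at h 0. If undefined there, \<gamma> is empty; if the value is h k, then
  \<gamma> is the k-th power of the chain. The case k = 0 would be the identity on X, of rank
  n.\<close>

lemma commutes_with_chain:
  assumes \<gamma>: "\<gamma> \<in> rank_ideal X r - {Map.empty}" "r < n"
    and comm: "\<gamma> \<circ>\<^sub>m restr (X - {h (n - 1)}) = restr (X - {h (n - 1)}) \<circ>\<^sub>m \<gamma>"
  obtains k where "1 \<le> k" "k < n"
    "\<And>i. i < n \<Longrightarrow> \<gamma> (h i) = (if i + k < n then Some (h (i + k)) else None)"
proof -
  let ?\<alpha> = "restr (X - {h (n - 1)})"
  note \<gamma>' = rank_ideal_simps[of \<gamma> X r]
  \<comment> \<open>Removing the last point h (n - 1) from the domain eliminates the wrap-around of
    the cycle.\<close>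
  have \<alpha>: "?\<alpha> (h i) = (if Suc i < n then Some (h (Suc i)) else None)" if "i < n" for i
    using that h_mem[OF that] h_eq_iff[of i "n - 1"] by (auto simp: restrict_map_def cyclic_shift_h)
  have step: "\<gamma> (h (Suc i)) = (case \<gamma> (h i) of None \<Rightarrow> None | Some y \<Rightarrow> ?\<alpha> y)"
    if "Suc i < n" for i
    using fun_cong[OF comm, of "h i"] \<alpha>[of i] that by (simp add: map_comp_def cong: option.case_cong)
  have "\<gamma> (h 0) \<noteq> None"
  proof
    assume *: "\<gamma> (h 0) = None"
    have "i < n \<longrightarrow> \<gamma> (h i) = None" for i
      by (induction i) (use * step in auto)
    then have "\<gamma> x = None" for x
      using \<gamma>'(1) \<gamma>(1) by (metis DiffD1 X_cases domIff subsetD)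
    then show False
      using \<gamma>(1) by auto
  qed
  then obtain k where k: "k < n" "\<gamma> (h 0) = Some (h k)"
    using \<gamma>'(2) \<gamma>(1) by (metis DiffD1 X_cases not_None_eq ranI subsetD)
  have **: "i < n \<longrightarrow> \<gamma> (h i) = (if i + k < n then Some (h (i + k)) else None)" for i
    by (induction i) (use k step \<alpha> in auto)
  have "k \<noteq> 0"
  proof
    assume "k = 0"
    then have "X \<subseteq> dom \<gamma>"
      using ** by (metis X_cases add_0_right domI subsetI)
    then show False
      using \<gamma>' \<gamma> card_X by (metis DiffD1 leD subset_antisym)
  qed
  then show thesis
    using that[of k] k(1) ** by simp
qed

text \<open>Reversing the enumeration makes \<open>commutes_with_chain\<close> available for the
  reversed chain as well, whose last point is h 0.\<close>

lemma reversed_cycle: "cycle (\<lambda>i. h (n - 1 - i)) n X"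
proof
  have "bij_betw (\<lambda>i. n - 1 - i) {..<n} {..<n}"
    by (rule bij_betw_byWitness[where f' = "\<lambda>i. n - 1 - i"]) auto
  then show "bij_betw (\<lambda>i. h (n - 1 - i)) {..<n} X"
    using bij_betw_trans[OF _ h] by (simp add: comp_def)
qed

end

text \<open>Here \<gamma> moves indices up by some k and \<delta> moves them down by some l, both
  positive. Comparing the two products at the two ends of the chain gives contradictory
  inequalities.\<close>

lemma chain_and_reversed_chain:
  assumes "cycle h n X" "1 \<le> r" "r < n"
    and \<gamma>: "\<gamma> \<in> rank_ideal X r - {Map.empty}"
      "\<gamma> \<circ>\<^sub>m cycle.restr h n (X - {h (n - 1)}) = cycle.restr h n (X - {h (n - 1)}) \<circ>\<^sub>m \<gamma>"
    and \<delta>: "\<delta> \<in> rank_ideal X r - {Map.empty}"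
      "\<delta> \<circ>\<^sub>m cycle.restr (\<lambda>i. h (n - 1 - i)) n (X - {h 0}) =
       cycle.restr (\<lambda>i. h (n - 1 - i)) n (X - {h 0}) \<circ>\<^sub>m \<delta>"
  shows "\<gamma> \<circ>\<^sub>m \<delta> \<noteq> \<delta> \<circ>\<^sub>m \<gamma>"
proof
  assume comm: "\<gamma> \<circ>\<^sub>m \<delta> = \<delta> \<circ>\<^sub>m \<gamma>"
  interpret cycle h n X by fact
  interpret rev: cycle "\<lambda>i. h (n - 1 - i)" n X by (rule reversed_cycle)
  obtain k where k: "1 \<le> k" "k < n"
    "\<And>i. i < n \<Longrightarrow> \<gamma> (h i) = (if i + k < n then Some (h (i + k)) else None)"
    using commutes_with_chain[OF \<gamma>(1) assms(3) \<gamma>(2)] by blast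
  obtain l where l: "1 \<le> l" "l < n"
    "\<And>i. i < n \<Longrightarrow> \<delta> (h (n - 1 - i)) = (if i + l < n then Some (h (n - 1 - (i + l))) else None)"
    using rev.commutes_with_chain[OF \<delta>(1) assms(3)] \<delta>(2) by auto
  \<comment> \<open>Substitute j = n - 1 - i; then i + l < n becomes l \<le> j.\<close>
  have \<delta>': "\<delta> (h j) = (if l \<le> j then Some (h (j - l)) else None)" if "j < n" for j
    using l(3)[of "n - 1 - j"] that by (auto simp: Suc_diff_Suc)
  \<comment> \<open>Since \<delta> is undefined at h 0, commutation makes it undefined at h k too,
    the image of h 0 under \<gamma>. The next inequality is the mirror argument at h (n - 1), where
    \<gamma> is undefined.\<close>
  have "k < l"
    using fun_cong[OF comm, of "h 0"] k(1,2) k(3)[of 0] \<delta>'[of 0] \<delta>'[of k] l(1)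
    by (auto simp: map_comp_def split: if_splits)
  moreover have "l < k"
    using fun_cong[OF comm, of "h (n - 1)"] k(1,2) k(3)[of "n - 1"] k(3)[of "n - 1 - l"]
      \<delta>'[of "n - 1"] l(1,2)
    by (auto simp: map_comp_def split: if_splits)
  ultimately show False
    by simp
qed

section \<open>Vertices that are far apart\<close>

context proper_rank_ideal
begin

lemma not_relpow_1: "\<exists>\<alpha> \<beta>. \<alpha> \<in> rank_ideal X r - {Map.empty} \<and> \<beta> \<in> rank_ideal X r - {Map.empty} \<and>
    (\<alpha>, \<beta>) \<notin> C ^^ 1"
proof -
  obtain x y where xy: "x \<in> X" "y \<in> X" "x \<noteq> y"
    using r_pos r_less by (metis One_nat_def card_le_Suc0_iff_eq finite_X leD le_less_trans)
  \<comment> \<open>The two products are the partial identities on {y} and on {x}, and only the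
    first is defined at y.\<close>
  have "([x \<mapsto> y] \<circ>\<^sub>m [y \<mapsto> x]) y \<noteq> ([y \<mapsto> x] \<circ>\<^sub>m [x \<mapsto> y]) y"
    using xy(3) by (simp add: map_comp_def)
  then have "([x \<mapsto> y], [y \<mapsto> x]) \<notin> C"
    unfolding C_iff by metis
  then show ?thesis
    using rank_one_mem[OF xy(1,2) r_pos] rank_one_mem[OF xy(2,1) r_pos]
    unfolding relpow_1 by blast
qed

text \<open>Taking A of size exactly r leaves a complement of size n - r \<le> r, so both
  restrictions of the cycle belong to the ideal.\<close>

lemma not_relpow_2:
  assumes "card X \<le> 2 * r"
  shows "\<exists>\<alpha> \<beta>. \<alpha> \<in> rank_ideal X r - {Map.empty} \<and> \<beta> \<in> rank_ideal X r - {Map.empty} \<and>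
    (\<alpha>, \<beta>) \<notin> C ^^ 2"
proof -
  obtain h where "bij_betw h {..<card X} X"
    using ex_bij_betw_nat_finite[OF finite_X] by (auto simp: atLeast0LessThan)
  then interpret cycle h "card X" X by unfold_locales
  obtain A where A: "A \<subseteq> X" "card A = r" "finite A"
    using obtain_subset_with_card_n[of r X] r_less by (metis less_imp_le)
  have card: "card (X - A) = card X - r"
    using A by (simp add: card_Diff_subset)
  have "restr A \<in> rank_ideal X r - {Map.empty}"
    using A r_pos by (intro restr_mem) auto
  moreover have "restr (X - A) \<in> rank_ideal X r - {Map.empty}"
  proof (rule restr_mem)
    show "X - A \<noteq> {}"
      using card r_less by (intro notI) simp
  qed (use card assms in auto)
  moreover have "(restr A, restr (X - A)) \<notin> C ^^ 2"
  proof
    assume "(restr A, restr (X - A)) \<in> C ^^ 2"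
    then obtain \<gamma> where "(restr A, \<gamma>) \<in> C" "(\<gamma>, restr (X - A)) \<in> C"
      by (auto simp: numeral_2_eq_2)
    then show False
      using commutes_with_complementary_restrs[of \<gamma> r A] A(1) r_less by (simp add: C_iff)
  qed
  ultimately show ?thesis
    by blast
qed

text \<open>The chain and its reversal have rank n - 1, which is why this applies to the largest
  proper ideal. The inner vertices of a path of length 3 between them would be the commuting pair
  excluded by \<open>chain_and_reversed_chain\<close>.\<close>

lemma not_relpow_3:
  assumes "r = card X - 1" "3 \<le> card X"
  shows "\<exists>\<alpha> \<beta>. \<alpha> \<in> rank_ideal X r - {Map.empty} \<and> \<beta> \<in> rank_ideal X r - {Map.empty} \<and>
    (\<alpha>, \<beta>) \<notin> C ^^ 3"
proof -
  obtain h where "bij_betw h {..<card X} X"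
    using ex_bij_betw_nat_finite[OF finite_X] by (auto simp: atLeast0LessThan)
  then interpret cycle h "card X" X by unfold_locales
  interpret rev: cycle "\<lambda>i. h (card X - 1 - i)" "card X" X by (rule reversed_cycle)
  let ?\<alpha> = "restr (X - {h (card X - 1)})" and ?\<beta> = "rev.restr (X - {h 0})"
  have ne: "X - {x} \<noteq> {}" for x
  proof
    assume "X - {x} = {}"
    then have "card X \<le> card {x}"
      by (intro card_mono) auto
    then show False
      using assms(2) by simp
  qed
  have "?\<alpha> \<in> rank_ideal X r - {Map.empty}"
    using assms ne h_mem[of "card X - 1"] by (intro restr_mem) (auto simp: card_Diff_singleton)
  moreover have "?\<beta> \<in> rank_ideal X r - {Map.empty}"
    using assms ne h_mem[of 0] by (intro rev.restr_mem) (auto simp: card_Diff_singleton)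
  moreover have "(?\<alpha>, ?\<beta>) \<notin> C ^^ 3"
  proof
    assume "(?\<alpha>, ?\<beta>) \<in> C ^^ 3"
    then obtain \<gamma> \<delta> where "(?\<alpha>, \<gamma>) \<in> C" "(\<gamma>, \<delta>) \<in> C" "(\<delta>, ?\<beta>) \<in> C"
      by (auto simp: numeral_3_eq_3)
    then show False
      using chain_and_reversed_chain[OF cycle_axioms r_pos r_less, of \<gamma> \<delta>] by (simp add: C_iff)
  qed
  ultimately show ?thesis
    by blast
qed

lemma diameter_eqI:
  assumes "\<And>\<alpha> \<beta>. \<alpha> \<in> rank_ideal X r - {Map.empty} \<Longrightarrow> \<beta> \<in> rank_ideal X r - {Map.empty} \<Longrightarrow>
      (\<alpha>, \<beta>) \<in> C ^^ Suc k"
    and "\<exists>\<alpha> \<beta>. \<alpha> \<in> rank_ideal X r - {Map.empty} \<and> \<beta> \<in> rank_ideal X r - {Map.empty} \<and>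
      (\<alpha>, \<beta>) \<notin> C ^^ k"
  shows "diameter (commuting_graph (\<circ>\<^sub>m) (rank_ideal X r)) = ereal (real (Suc k))"
proof -
  obtain \<alpha> \<beta> where "\<alpha> \<in> rank_ideal X r - {Map.empty}" "\<beta> \<in> rank_ideal X r - {Map.empty}"
      "(\<alpha>, \<beta>) \<notin> C ^^ k"
    using assms(2) by blast
  then show ?thesis
    by (intro diameter_commuting_graph_eqI[where a = \<alpha> and b = \<beta>, of "rank_ideal X r" "(\<circ>\<^sub>m)",
          unfolded center] assms(1))
qed

end

theorem theorem6p7:
  fixes X :: "'a set" and n :: nat
  assumes "finite X" and "n = card X" and "n \<ge> 3"
  shows "diameter (commuting_graph (\<circ>\<^sub>m) (rank_ideal X (n - 1))) = 4 \<and>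
    (\<forall>r. (n - 1) div 2 < r \<and> r < n - 1 \<longrightarrow>
           diameter (commuting_graph (\<circ>\<^sub>m) (rank_ideal X r)) = 3) \<and>
    (\<forall>r. 1 \<le> r \<and> r \<le> (n - 1) div 2 \<longrightarrow>
           diameter (commuting_graph (\<circ>\<^sub>m) (rank_ideal X r)) = 2)"
proof (intro conjI allI impI)
  interpret proper_rank_ideal X "n - 1"
    using assms by unfold_locales auto
  show "diameter (commuting_graph (\<circ>\<^sub>m) (rank_ideal X (n - 1))) = 4"
    using diameter_eqI[of 3] relpow_4 not_relpow_3 assms by simp
next
  fix r assume r: "(n - 1) div 2 < r \<and> r < n - 1"
  then interpret proper_rank_ideal X r
    using assms by unfold_locales auto
  \<comment> \<open>For integers, (n - 1) div 2 < r says the same as n \<le> 2r.\<close>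
  have "card X \<le> 2 * r" "r + 1 < card X"
    using assms r by linarith+
  then show "diameter (commuting_graph (\<circ>\<^sub>m) (rank_ideal X r)) = 3"
    using diameter_eqI[of 2] relpow_3 not_relpow_2 by simp
next
  fix r assume r: "1 \<le> r \<and> r \<le> (n - 1) div 2"
  then interpret proper_rank_ideal X r
    using assms by unfold_locales auto
  have "2 * r < card X"
    using assms r by linarith
  then show "diameter (commuting_graph (\<circ>\<^sub>m) (rank_ideal X r)) = 2"
    using diameter_eqI[of 1] relpow_2 not_relpow_1 by (simp add: numeral_2_eq_2)
qed

end
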